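(* Let $A\in\mathbb{R}^{n\times n}$ be a real symmetric matrix. Then $A$ is positive semidefinite if and only if it can be factorized as $A=RR^\top$, where $R=(r_{ij})\in\mathbb{R}^{n\times n}$ is lower triangular with non-negative diagonal entries $r_{11},\dots,r_{nn}\ge 0$. The factorization is not always unique (there exist positive semidefinite matrices with more than one such factor $R$). Moreover, every positive semidefinite $A$ admits such a factorization for which $r_{nn}=0$ only if $\mathrm{rank}(A)=\mathrm{rank}([A]_{n-1})$.
   Context: A symmetric $A\in\mathbb{R}^{n\times n}$ is positive semidefinite if $x^\top A x\ge 0$ for all $x\in\mathbb{R}^n$. $[A]_{n-1}$ denotes the leading principal submatrix of $A$ of size $(n-1)\times(n-1)$ (rows and columns $1,\dots,n-1$). *)

theory Defs
  imports Complex_Main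
    "Jordan_Normal_Form.DL_Rank"
    "Jordan_Normal_Form.DL_Submatrix"
begin

definition psd_mat :: "real mat \<Rightarrow> bool" where
  "psd_mat A \<longleftrightarrow> square_mat A \<and> A\<^sup>T = A \<and>
     (\<forall>x \<in> carrier_vec (dim_row A). x \<bullet> (A *\<^sub>v x) \<ge> 0)"

definition lower_triangular :: "'a::zero mat \<Rightarrow> bool" where
  "lower_triangular R \<longleftrightarrow>
     (\<forall>i < dim_row R. \<forall>j < dim_col R. i < j \<longrightarrow> R $$ (i, j) = 0)"

definition cholesky_factor :: "nat \<Rightarrow> real mat \<Rightarrow> real mat \<Rightarrow> bool" where
  "cholesky_factor n A R \<longleftrightarrow> R \<in> carrier_mat n n \<and> lower_triangular R \<and>
     (\<forall>i < n. R $$ (i, i) \<ge> 0) \<and> A = R * R\<^sup>T"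

definition leading_principal_submatrix :: "'a mat \<Rightarrow> nat \<Rightarrow> 'a mat" where
  "leading_principal_submatrix A k = submatrix A {..<k} {..<k}"

lemma leading_principal_submatrix_eq:
  assumes "A \<in> carrier_mat n n" "k \<le> n"
  shows "leading_principal_submatrix A k = mat k k (\<lambda>(i, j). A $$ (i, j))"
proof -
  have pick: "pick {..<k} i = i" if "i < k" for i
  proof -
    have "{a \<in> {..<k}. a < i} = {..<i}" using that by auto
    then show ?thesis using pick_card_in_set[of i "{..<k}"] that by simp
  qed
  have card: "card {i. i < n \<and> i \<in> {..<k}} = k"
  proof -
    have "{i. i < n \<and> i \<in> {..<k}} = {..<k}" using assms(2) by auto
    then show ?thesis by simp
  qed
  show ?thesis
    using assms(1) card unfolding leading_principal_submatrix_def submatrix_def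
    by (auto simp: pick intro!: eq_matI)
qed

end

theory Submission
  imports Defs "Jordan_Normal_Form.Matrix_Kernel"
begin

text \<open>Cholesky elimination starting at the top-left entry: the Schur complement of a positive
semidefinite form is again positive semidefinite, and a zero pivot forces its whole row to vanish.
If the last pivot of the elimination is zero, back substitution produces a kernel vector \<open>z\<close> of \<open>A\<close>
with last entry \<open>1\<close>. Hence the last column of \<open>A\<close>, and by symmetry its last row, depends linearly
on the others, so deleting both preserves the rank: deleting the column does not change the image,
deleting the row does not change the kernel.\<close>

section \<open>Rank, image and kernel of a matrix\<close>

lemma linear_map_mult_mat_vec:
  fixes A :: "'a::field mat"
  assumes A: "A \<in> carrier_mat nr nc"
  shows "linear_map class_ring (module_vec TYPE('a) nc) (module_vec TYPE('a) nr) ((*\<^sub>v) A)"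
proof -
  interpret V: vec_space "TYPE('a)" nc .
  interpret W: vec_space "TYPE('a)" nr .
  show ?thesis
  proof (intro linear_map.intro mod_hom.intro)
    show "mod_hom_axioms class_ring (module_vec TYPE('a) nc) (module_vec TYPE('a) nr) ((*\<^sub>v) A)"
      unfolding mod_hom_axioms_def LinearCombinations.module_hom_def
      using A by (auto simp: mult_add_distrib_mat_vec mult_mat_vec module_vec_simps)
  qed (rule V.vectorspace_axioms W.vectorspace_axioms V.module_axioms W.module_axioms)+
qed

text \<open>Rank-nullity for multiplication by \<open>A\<close>, whose image is the column space and
  whose kernel is \<open>mat_kernel A\<close>.\<close>

lemma rank_plus_dim_mat_kernel:
  fixes A :: "'a::field mat"
  assumes A: "A \<in> carrier_mat nr nc"
  shows "vec_space.rank nr A +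
    vectorspace.dim class_ring ((module_vec TYPE('a) nc)\<lparr>carrier := mat_kernel A\<rparr>) = nc"
proof -
  interpret V: vec_space "TYPE('a)" nc .
  interpret W: vec_space "TYPE('a)" nr .
  interpret T: linear_map class_ring "module_vec TYPE('a) nc" "module_vec TYPE('a) nr" "(*\<^sub>v) A"
    by (rule linear_map_mult_mat_vec[OF A])
  have "T.imT = W.col_space A"
    using A unfolding T.im_def W.col_space_eq[OF A] by (auto simp: module_vec_simps)
  moreover have "T.kerT = mat_kernel A"
    using A unfolding T.ker_def by (auto simp: mat_kernel module_vec_simps)
  ultimately show ?thesis
    using T.rank_nullity[OF V.fin_dim] V.dim_is_n
    unfolding W.rank_def W.col_space_def by simp
qed

text \<open>By rank-nullity the kernel and the number of columns determine the rank. The row counts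
  may differ, which is what permits deleting a row.\<close>

lemma rank_eq_if_mat_kernel_eq:
  fixes A B :: "'a::field mat"
  assumes "A \<in> carrier_mat n nc" "B \<in> carrier_mat m nc" "mat_kernel A = mat_kernel B"
  shows "vec_space.rank n A = vec_space.rank m B"
  using rank_plus_dim_mat_kernel[OF assms(1)] rank_plus_dim_mat_kernel[OF assms(2)] assms(3)
  by simp

text \<open>The two deletions are separate: \<open>B\<close> is \<open>A\<close> without its last
  column and has the same column space; the leading block is \<open>B\<close> without its last row
  and has the same kernel. Symmetry enters only in the second.\<close>

lemma rank_leading_block_of_kernel_vec:
  fixes A :: "'a::field mat"
  assumes A: "A \<in> carrier_mat (Suc n) (Suc n)" and sym: "A\<^sup>T = A"
    and z: "z \<in> carrier_vec (Suc n)" "z $ n = 1" "A *\<^sub>v z = 0\<^sub>v (Suc n)"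
  shows "vec_space.rank (Suc n) A = vec_space.rank n (mat n n (\<lambda>(i, j). A $$ (i, j)))"
proof -
  define B where "B = mat (Suc n) n (\<lambda>(i, j). A $$ (i, j))"
  have B: "B \<in> carrier_mat (Suc n) n" unfolding B_def by simp
  interpret W: vec_space "TYPE('a)" "Suc n" .
  have Ax: "(A *\<^sub>v x) $ i = (\<Sum>j<n. A $$ (i,j) * x $ j) + A $$ (i,n) * x $ n"
    if "x \<in> carrier_vec (Suc n)" "i < Suc n" for x i
    using A that by (simp add: scalar_prod_def atLeast0LessThan)
  have By: "(B *\<^sub>v y) $ i = (\<Sum>j<n. A $$ (i,j) * y $ j)"
    if "y \<in> carrier_vec n" "i < Suc n" for y i
    using that by (simp add: B_def scalar_prod_def atLeast0LessThan)
  \<comment> \<open>Subtracting \<open>x $ n\<close> times the kernel vector \<open>z\<close> keeps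
    the image and, as \<open>z $ n = 1\<close>, clears the last entry, so only the columns of
    \<open>B\<close> act.\<close>
  have AB: "A *\<^sub>v x = B *\<^sub>v vec n (\<lambda>j. x $ j - x $ n * z $ j)" if x: "x \<in> carrier_vec (Suc n)" for x
  proof
    show "dim_vec (A *\<^sub>v x) = dim_vec (B *\<^sub>v vec n (\<lambda>j. x $ j - x $ n * z $ j))"
      using A B by simp
    fix i assume "i < dim_vec (B *\<^sub>v vec n (\<lambda>j. x $ j - x $ n * z $ j))"
    hence i: "i < Suc n" using B by simp
    have "A $$ (i,n) = - (\<Sum>j<n. A $$ (i,j) * z $ j)"
      using Ax[OF z(1) i] z i by (simp add: eq_neg_iff_add_eq_0 add.commute)
    thus "(A *\<^sub>v x) $ i = (B *\<^sub>v vec n (\<lambda>j. x $ j - x $ n * z $ j)) $ i"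
      using Ax[OF x i] By[of "vec n (\<lambda>j. x $ j - x $ n * z $ j)" i] i
      by (simp add: right_diff_distrib sum_subtractf sum_distrib_left mult_ac)
  qed
  have BA: "B *\<^sub>v y = A *\<^sub>v vec (Suc n) (\<lambda>j. if j = n then 0 else y $ j)"
    if y: "y \<in> carrier_vec n" for y
  proof
    fix i assume "i < dim_vec (A *\<^sub>v vec (Suc n) (\<lambda>j. if j = n then 0 else y $ j))"
    hence i: "i < Suc n" using A by simp
    show "(B *\<^sub>v y) $ i = (A *\<^sub>v vec (Suc n) (\<lambda>j. if j = n then 0 else y $ j)) $ i"
      using By[OF y i] Ax[of "vec (Suc n) (\<lambda>j. if j = n then 0 else y $ j)", OF _ i] by simp
  qed (use A B in simp)
  have "(\<exists>x\<in>carrier_vec (Suc n). A *\<^sub>v x = w) \<longleftrightarrow> (\<exists>y\<in>carrier_vec n. B *\<^sub>v y = w)" for w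
    by (metis AB BA vec_carrier)
  hence "W.col_space A = W.col_space B"
    unfolding W.col_space_eq[OF A] W.col_space_eq[OF B] using A B by simp
  hence "W.rank A = W.rank B" unfolding W.rank_def W.col_space_def by simp
  moreover have "mat_kernel B = mat_kernel (mat n n (\<lambda>(i, j). A $$ (i, j)))" (is "_ = mat_kernel ?C")
  proof -
    have By0: "B *\<^sub>v y = 0\<^sub>v (Suc n) \<longleftrightarrow> ?C *\<^sub>v y = 0\<^sub>v n" if y: "y \<in> carrier_vec n" for y
    proof -
      have Cy: "(?C *\<^sub>v y) $ i = (\<Sum>j<n. A $$ (i,j) * y $ j)" if "i < n" for i
        using that y by (simp add: scalar_prod_def atLeast0LessThan)
      have 1: "B *\<^sub>v y = 0\<^sub>v (Suc n) \<longleftrightarrow> (\<forall>i<Suc n. (\<Sum>j<n. A $$ (i,j) * y $ j) = 0)"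
        using By[OF y] B by (auto simp: vec_eq_iff simp del: index_mult_mat_vec)
      have 2: "?C *\<^sub>v y = 0\<^sub>v n \<longleftrightarrow> (\<forall>i<n. (\<Sum>j<n. A $$ (i,j) * y $ j) = 0)"
        using Cy by (auto simp: vec_eq_iff simp del: index_mult_mat_vec)
      \<comment> \<open>By symmetry the column relation given by \<open>z\<close> is also a relation
        between the rows.\<close>
      have "A $$ (n,j) = - (\<Sum>i<n. z $ i * A $$ (i,j))" if j: "j < n" for j
      proof -
        have s: "A $$ (i,j) = A $$ (j,i)" if "i < Suc n" for i
          using that j A arg_cong[OF sym, of "\<lambda>M. M $$ (i,j)"] by simp
        show ?thesis using Ax[OF z(1), of j] z j by (simp add: s eq_neg_iff_add_eq_0 mult.commute add.commute)
      qed
      hence "(\<Sum>j<n. A $$ (n,j) * y $ j) = - (\<Sum>j<n. \<Sum>i<n. z $ i * A $$ (i,j) * y $ j)"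
        by (simp add: sum_negf sum_distrib_right)
      also have "\<dots> = - (\<Sum>i<n. z $ i * (\<Sum>j<n. A $$ (i,j) * y $ j))"
        by (subst sum.swap) (simp add: sum_distrib_left mult.assoc)
      finally show ?thesis unfolding 1 2 by (auto simp: less_Suc_eq)
    qed
    thus ?thesis using mat_kernel[OF B] mat_kernel[of ?C n n] by auto
  qed
  ultimately show ?thesis
    using rank_eq_if_mat_kernel_eq[OF B, of "mat n n (\<lambda>(i, j). A $$ (i, j))" n] by simp
qed

section \<open>Elimination on quadratic forms\<close>

text \<open>Isolates the variable \<open>x 0\<close> as a quadratic polynomial, ready for completing
  the square.\<close>

lemma quadratic_form_Suc:
  fixes a :: "nat \<Rightarrow> nat \<Rightarrow> 'a::comm_ring_1"
  assumes "\<And>i. i \<le> n \<Longrightarrow> a (Suc i) 0 = a 0 (Suc i)"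
  shows "(\<Sum>i\<le>Suc n. \<Sum>j\<le>Suc n. x i * a i j * x j) =
    a 0 0 * (x 0)\<^sup>2 + 2 * x 0 * (\<Sum>j\<le>n. a 0 (Suc j) * x (Suc j)) +
    (\<Sum>i\<le>n. \<Sum>j\<le>n. x (Suc i) * a (Suc i) (Suc j) * x (Suc j))"
proof -
  have "(\<Sum>i\<le>n. x (Suc i) * a (Suc i) 0 * x 0) = x 0 * (\<Sum>j\<le>n. a 0 (Suc j) * x (Suc j))"
    using assms by (simp add: sum_distrib_left mult_ac)
  thus ?thesis
    by (simp add: sum.atMost_Suc_shift sum.distrib sum_distrib_left power2_eq_square algebra_simps
        del: sum.atMost_Suc)
qed

text \<open>With a zero pivot, the form at a vector with entry \<open>t\<close> at \<open>0\<close>,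
  entry \<open>1\<close> at \<open>Suc k\<close> and zeros elsewhere is affine in \<open>t\<close>
  with slope \<open>2 * a 0 (Suc k)\<close>, hence bounded below only if that slope
  vanishes.\<close>

lemma psd_form_zero_pivot:
  fixes a :: "nat \<Rightarrow> nat \<Rightarrow> real"
  assumes sym: "\<And>i j. i \<le> Suc n \<Longrightarrow> j \<le> Suc n \<Longrightarrow> a i j = a j i"
    and psd: "\<And>x. 0 \<le> (\<Sum>i\<le>Suc n. \<Sum>j\<le>Suc n. x i * a i j * x j)"
    and "a 0 0 = 0" "k \<le> n"
  shows "a 0 (Suc k) = 0"
proof (rule ccontr)
  assume nz: "a 0 (Suc k) \<noteq> 0"
  \<comment> \<open>chosen so that the form takes the value \<open>-1\<close> at \<open>x\<close>\<close>
  define t where "t = - (a (Suc k) (Suc k) + 1) / (2 * a 0 (Suc k))"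
  define x where "x = (\<lambda>i. if i = 0 then t else if i = Suc k then 1 else 0)"
  have "x (Suc i) * a (Suc i) (Suc j) * x (Suc j) =
      (if j = k then if i = k then a (Suc k) (Suc k) else 0 else 0)" for i j
    by (simp add: x_def)
  hence "(\<Sum>i\<le>n. \<Sum>j\<le>n. x (Suc i) * a (Suc i) (Suc j) * x (Suc j)) = a (Suc k) (Suc k)"
    using \<open>k \<le> n\<close> by simp
  moreover have "a 0 (Suc j) * x (Suc j) = (if j = k then a 0 (Suc k) else 0)" for j
    by (simp add: x_def)
  hence "(\<Sum>j\<le>n. a 0 (Suc j) * x (Suc j)) = a 0 (Suc k)"
    using \<open>k \<le> n\<close> by simp
  ultimately have "(\<Sum>i\<le>Suc n. \<Sum>j\<le>Suc n. x i * a i j * x j) = 2 * t * a 0 (Suc k) + a (Suc k) (Suc k)"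
    using \<open>a 0 0 = 0\<close> sym by (subst quadratic_form_Suc) (auto simp: x_def)
  also have "\<dots> = -1" using nz by (simp add: t_def field_simps)
  finally show False using psd[of x] by simp
qed

text \<open>Functions on indices replace matrices so that the induction can pass to the Schur
  complement by shifting with \<open>Suc\<close>. The kernel vector is part of the claim because the
  last pivot is inherited from the Schur complement.\<close>

lemma psd_form_cholesky:
  fixes a :: "nat \<Rightarrow> nat \<Rightarrow> real"
  assumes "\<And>i j. i \<le> n \<Longrightarrow> j \<le> n \<Longrightarrow> a i j = a j i"
    and "\<And>x. 0 \<le> (\<Sum>i\<le>n. \<Sum>j\<le>n. x i * a i j * x j)"
  shows "\<exists>r. (\<forall>i j. i < j \<longrightarrow> r i j = 0) \<and> (\<forall>i. 0 \<le> r i i) \<and>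
    (\<forall>i\<le>n. \<forall>j\<le>n. a i j = (\<Sum>k\<le>n. r i k * r j k)) \<and>
    (r n n = 0 \<longrightarrow> (\<exists>z. z n = 1 \<and> (\<forall>i\<le>n. (\<Sum>j\<le>n. a i j * z j) = 0)))"
  using assms
proof (induction n arbitrary: a)
  case 0
  have "0 \<le> a 0 0" using "0.prems"(2)[of "\<lambda>_. 1"] by simp
  \<comment> \<open>A zero pivot here means \<open>a 0 0 = 0\<close>, so the constant
    \<open>1\<close> is a kernel vector.\<close>
  thus ?case
    by (intro exI[of _ "\<lambda>i j. if i = 0 \<and> j = 0 then sqrt (a 0 0) else 0"])
      (auto intro: exI[of _ "\<lambda>_. 1"])
next
  case (Suc n)
  note sym = Suc.prems(1) and psd = Suc.prems(2)
  define c where "c = a 0 0"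
  define b where "b = (\<lambda>i. a 0 (Suc i))"
  \<comment> \<open>When \<open>c = 0\<close> also \<open>b = 0\<close>, so because \<open>x / 0 = 0\<close> the formulas for a positive pivot
      remain correct for a zero pivot.\<close>
  define s where "s = (\<lambda>i j. a (Suc i) (Suc j) - b i * b j / c)"
  have row0: "a 0 (Suc i) = b i" for i by (simp add: b_def)
  have col0: "a (Suc i) 0 = b i" if "i \<le> n" for i using sym that by (simp add: b_def)
  note q = quadratic_form_Suc[of n a, OF sym, simplified]
  have c: "0 \<le> c"
    using psd[of "\<lambda>i. if i = 0 then 1 else 0"] q[of "\<lambda>i. if i = 0 then 1 else 0"] by (simp add: c_def)
  have b0: "b i = 0" if "c = 0" "i \<le> n" for i
    using psd_form_zero_pivot[of n a i, OF sym psd] that by (simp add: b_def c_def)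
  have s_form: "(\<Sum>i\<le>n. \<Sum>j\<le>n. x i * s i j * x j) =
      (\<Sum>i\<le>n. \<Sum>j\<le>n. x i * a (Suc i) (Suc j) * x j) - (\<Sum>j\<le>n. b j * x j)\<^sup>2 / c" for x
    by (simp add: s_def algebra_simps sum_subtractf power2_eq_square sum_product sum_divide_distrib)
  have s_psd: "0 \<le> (\<Sum>i\<le>n. \<Sum>j\<le>n. x i * s i j * x j)" for x
  proof -
    define l where "l = (\<Sum>j\<le>n. b j * x j)"
    have "l = 0" if "c = 0" using b0 that by (simp add: l_def)
    hence e: "c * (l / c)\<^sup>2 - 2 * (l / c) * l = - (l\<^sup>2 / c)"
      by (cases "c = 0") (simp_all add: power2_eq_square field_simps)
    \<comment> \<open>For \<open>c > 0\<close> the first entry minimizes the form in that variable;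
      for \<open>c = 0\<close> it is \<open>0\<close>. In both cases the form of \<open>a\<close> at
      \<open>y\<close> equals the form of \<open>s\<close> at \<open>x\<close>.\<close>
    define y where "y = (\<lambda>i. case i of 0 \<Rightarrow> - l / c | Suc j \<Rightarrow> x j)"
    have "0 \<le> c * (l / c)\<^sup>2 - 2 * (l / c) * l + (\<Sum>i\<le>n. \<Sum>j\<le>n. x i * a (Suc i) (Suc j) * x j)"
      using psd[of y] q[of y] by (simp add: y_def c_def b_def l_def)
    thus ?thesis using e by (simp add: s_form l_def)
  qed
  have s_sym: "s i j = s j i" if "i \<le> n" "j \<le> n" for i j using sym that by (simp add: s_def mult.commute)
  from Suc.IH[of s, OF s_sym s_psd] obtain r where r:
    "\<And>i j. i < j \<Longrightarrow> r i j = 0" "\<And>i. 0 \<le> r i i"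
    "\<And>i j. i \<le> n \<Longrightarrow> j \<le> n \<Longrightarrow> s i j = (\<Sum>k\<le>n. r i k * r j k)"
    "r n n = 0 \<Longrightarrow> \<exists>z. z n = 1 \<and> (\<forall>i\<le>n. (\<Sum>j\<le>n. s i j * z j) = 0)"
    by blast
  \<comment> \<open>The factor \<open>r\<close> of the Schur complement, bordered by a new first row
    and column. Its last diagonal entry is still \<open>r n n\<close>.\<close>
  define r' where "r' = (\<lambda>i j. case i of 0 \<Rightarrow> (if j = 0 then sqrt c else 0)
    | Suc i \<Rightarrow> (case j of 0 \<Rightarrow> b i / sqrt c | Suc j \<Rightarrow> r i j))"
  have r'_simps: "r' 0 0 = sqrt c" "r' 0 (Suc j) = 0" "r' (Suc i) 0 = b i / sqrt c"
    "r' (Suc i) (Suc j) = r i j" for i j by (simp_all add: r'_def)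
  have "r' i j = 0" if "i < j" for i j
    using that r(1) by (cases i; cases j) (auto simp: r'_simps)
  moreover have "0 \<le> r' i i" for i using r(2) c by (cases i) (auto simp: r'_simps)
  moreover have "a i j = (\<Sum>k\<le>Suc n. r' i k * r' j k)" if "i \<le> Suc n" "j \<le> Suc n" for i j
  proof -
    have b: "sqrt c * (b i / sqrt c) = b i" "b i / sqrt c * sqrt c = b i" if "i \<le> n" for i
      using that b0 by (cases "c = 0"; simp)+
    have bb: "b i / sqrt c * (b j / sqrt c) = b i * b j / c" for i j
      using c by simp
    show ?thesis using that c
      by (cases i; cases j)
        (simp_all add: sum.atMost_Suc_shift r'_simps b b0 bb col0 r(3)[symmetric] s_def
           c_def[symmetric] row0 del: sum.atMost_Suc)
  qed
  moreover have "\<exists>z. z (Suc n) = 1 \<and> (\<forall>i\<le>Suc n. (\<Sum>j\<le>Suc n. a i j * z j) = 0)"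
    if "r' (Suc n) (Suc n) = 0"
  proof -
    obtain z where z: "z n = 1" "\<And>i. i \<le> n \<Longrightarrow> (\<Sum>j\<le>n. s i j * z j) = 0"
      using r(4) \<open>r' (Suc n) (Suc n) = 0\<close> by (auto simp: r'_simps)
    define l where "l = (\<Sum>j\<le>n. b j * z j)"
    \<comment> \<open>Back substitution: the first entry solves row \<open>0\<close>, that is
      \<open>c * y 0 + l = 0\<close>, and the other rows then reduce to the kernel equations of
      \<open>s\<close>. If \<open>c = 0\<close>, then \<open>l = 0\<close> and row \<open>0\<close>
      holds trivially.\<close>
    define y where "y = (\<lambda>i. case i of 0 \<Rightarrow> - l / c | Suc j \<Rightarrow> z j)"
    have y: "y 0 = - l / c" "y (Suc j) = z j" for j by (simp_all add: y_def)
    have "(\<Sum>j\<le>Suc n. a i j * y j) = 0" if "i \<le> Suc n" for i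
    proof (cases i)
      case 0
      have "l = 0" if "c = 0" using b0 that by (simp add: l_def)
      thus ?thesis using 0
        by (cases "c = 0") (simp_all add: sum.atMost_Suc_shift y c_def[symmetric]
            row0 l_def[symmetric] del: sum.atMost_Suc)
    next
      case (Suc k)
      hence k: "k \<le> n" using that by simp
      have "(\<Sum>j\<le>n. s k j * z j) = (\<Sum>j\<le>n. a (Suc k) (Suc j) * z j) - b k * l / c"
        by (simp add: s_def l_def algebra_simps sum_subtractf sum_distrib_left sum_divide_distrib)
      thus ?thesis using z(2)[OF k] Suc k
        by (simp add: sum.atMost_Suc_shift y col0 del: sum.atMost_Suc)
    qed
    thus ?thesis using z(1) y by (intro exI[of _ y]) auto
  qed
  ultimately show ?case by (intro exI[of _ r']) blast
qed

section \<open>Transfer to matrices, and non-uniqueness\<close>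

lemma psd_mat_cholesky:
  assumes A: "A \<in> carrier_mat (Suc n) (Suc n)" and psd: "psd_mat A"
  obtains R where "cholesky_factor (Suc n) A R"
    "R $$ (n, n) = 0 \<Longrightarrow> \<exists>z \<in> carrier_vec (Suc n). z $ n = 1 \<and> A *\<^sub>v z = 0\<^sub>v (Suc n)"
proof -
  define a where "a = (\<lambda>i j. A $$ (i, j))"
  have Ax: "(A *\<^sub>v vec (Suc n) x) $ i = (\<Sum>j\<le>n. a i j * x j)" if "i \<le> n" for x i
    using A that by (simp add: scalar_prod_def atLeast0LessThan lessThan_Suc_atMost less_Suc_eq_le
        a_def del: sum.lessThan_Suc sum.atMost_Suc cong: sum.cong_simp)
  have nonneg: "0 \<le> (\<Sum>i\<le>n. \<Sum>j\<le>n. x i * a i j * x j)" for x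
  proof -
    have "0 \<le> vec (Suc n) x \<bullet> (A *\<^sub>v vec (Suc n) x)"
      using psd A by (simp add: psd_mat_def)
    also have "\<dots> = (\<Sum>i\<le>n. \<Sum>j\<le>n. x i * a i j * x j)"
      using A by (simp add: scalar_prod_def atLeast0LessThan lessThan_Suc_atMost less_Suc_eq_le Ax
          sum_distrib_left mult.assoc del: index_mult_mat_vec sum.lessThan_Suc sum.atMost_Suc
          cong: sum.cong_simp)
    finally show ?thesis .
  qed
  have sym: "a i j = a j i" if "i \<le> n" "j \<le> n" for i j
    using that A psd unfolding a_def psd_mat_def
    by (metis carrier_matD index_transpose_mat(1) le_imp_less_Suc)
  from psd_form_cholesky[of n a, OF sym nonneg] obtain r where r: "\<And>i j. i < j \<Longrightarrow> r i j = 0" "\<And>i. 0 \<le> r i i"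
    "\<And>i j. i \<le> n \<Longrightarrow> j \<le> n \<Longrightarrow> a i j = (\<Sum>k\<le>n. r i k * r j k)"
    "r n n = 0 \<Longrightarrow> \<exists>z. z n = 1 \<and> (\<forall>i\<le>n. (\<Sum>j\<le>n. a i j * z j) = 0)"
    by blast
  define R where "R = mat (Suc n) (Suc n) (\<lambda>(i, j). r i j)"
  have "A = R * R\<^sup>T"
  proof (rule eq_matI)
    fix i j assume "i < dim_row (R * R\<^sup>T)" "j < dim_col (R * R\<^sup>T)"
    hence ij: "i \<le> n" "j \<le> n" by (auto simp: R_def)
    hence "(R * R\<^sup>T) $$ (i, j) = (\<Sum>k\<le>n. r i k * r j k)"
      by (simp add: R_def scalar_prod_def atLeast0LessThan lessThan_Suc_atMost less_Suc_eq_le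
          del: sum.lessThan_Suc sum.atMost_Suc cong: sum.cong_simp)
    thus "A $$ (i, j) = (R * R\<^sup>T) $$ (i, j)" using r(3)[OF ij] by (simp add: a_def)
  qed (use A in \<open>auto simp: R_def\<close>)
  hence "cholesky_factor (Suc n) A R"
    using r(1,2) by (auto simp: cholesky_factor_def lower_triangular_def R_def)
  moreover have "\<exists>z \<in> carrier_vec (Suc n). z $ n = 1 \<and> A *\<^sub>v z = 0\<^sub>v (Suc n)"
    if "R $$ (n, n) = 0"
  proof -
    obtain z where z: "z n = 1" "\<And>i. i \<le> n \<Longrightarrow> (\<Sum>j\<le>n. a i j * z j) = 0"
      using r(4) \<open>R $$ (n, n) = 0\<close> by (auto simp: R_def)
    have "(A *\<^sub>v vec (Suc n) z) $ i = 0" if "i \<le> n" for i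
      using z(2)[OF that] Ax[OF that] by simp
    hence "A *\<^sub>v vec (Suc n) z = 0\<^sub>v (Suc n)"
      using A by (intro eq_vecI) (auto simp del: index_mult_mat_vec)
    thus ?thesis using z(1) by (intro bexI[of _ "vec (Suc n) z"]) auto
  qed
  ultimately show thesis using that by blast
qed

text \<open>The form of \<open>R * R\<^sup>T\<close> at \<open>x\<close> is the squared norm of
  \<open>R\<^sup>T *\<^sub>v x\<close>.\<close>

lemma cholesky_factor_imp_psd_mat:
  assumes "cholesky_factor n A R"
  shows "psd_mat A"
proof -
  from assms have R: "R \<in> carrier_mat n n" and A: "A = R * R\<^sup>T" by (auto simp: cholesky_factor_def)
  have "0 \<le> x \<bullet> (A *\<^sub>v x)" if x: "x \<in> carrier_vec n" for x
  proof -
    have "x \<bullet> (A *\<^sub>v x) = x \<bullet> (R *\<^sub>v (R\<^sup>T *\<^sub>v x))"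
      using R x unfolding A by (simp add: assoc_mult_mat_vec[of _ n n _ n])
    also have "\<dots> = (R\<^sup>T *\<^sub>v x) \<bullet> (R\<^sup>T *\<^sub>v x)"
      using R x by (simp add: transpose_vec_mult_scalar[of "R" n n])
    also have "\<dots> \<ge> 0" by (simp add: scalar_prod_def sum_nonneg)
    finally show ?thesis .
  qed
  moreover have "A\<^sup>T = A" using R unfolding A by (simp add: transpose_mult[of _ n n _ n])
  ultimately show ?thesis using R by (auto simp: psd_mat_def A)
qed

text \<open>For \<open>diag(0, 1)\<close> the zero first pivot leaves the first column of the factor
  free: the entry \<open>1\<close> of the second row may stand in either column. The diagonal choice
  is the idempotent matrix itself.\<close>

lemma cholesky_factor_not_unique:
  obtains A R R' where "A \<in> carrier_mat 2 2" "cholesky_factor 2 A R" "cholesky_factor 2 A R'" "R \<noteq> R'"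
proof
  let ?A = "mat 2 2 (\<lambda>(i, j). if i = 1 \<and> j = 1 then 1 else 0) :: real mat"
  let ?R = "mat 2 2 (\<lambda>(i, j). if i = 1 \<and> j = 0 then 1 else 0) :: real mat"
  show "?A \<in> carrier_mat 2 2" by simp
  show "cholesky_factor 2 ?A ?A" "cholesky_factor 2 ?A ?R"
    by (auto simp: cholesky_factor_def lower_triangular_def scalar_prod_def numeral_2_eq_2
        less_Suc_eq intro!: eq_matI)
  show "?A \<noteq> ?R" by (auto dest!: arg_cong[of _ _ "\<lambda>M. M $$ (1, 1)"])
qed

text \<open>The rank clause is about a suitable factor: for \<open>diag(0, 1)\<close>, the factor
  with its \<open>1\<close> below the diagonal ends in a zero diagonal entry, yet the rank drops
  from 1 to 0.\<close>

theorem proposition7: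
  shows "(\<forall>n \<ge> 1. \<forall>A \<in> carrier_mat n n. A\<^sup>T = A \<longrightarrow>
             (psd_mat A \<longleftrightarrow> (\<exists>R. cholesky_factor n A R)))
       \<and> (\<exists>n \<ge> 1. \<exists>A \<in> carrier_mat n n. psd_mat A \<and>
             (\<exists>R R'. cholesky_factor n A R \<and> cholesky_factor n A R' \<and> R \<noteq> R'))
       \<and> (\<forall>n \<ge> 1. \<forall>A \<in> carrier_mat n n. psd_mat A \<longrightarrow>
             (\<exists>R. cholesky_factor n A R \<and>
                (R $$ (n - 1, n - 1) = 0 \<longrightarrow>
                   vec_space.rank n A =
                   vec_space.rank (n - 1) (leading_principal_submatrix A (n - 1)))))"
proof (intro conjI allI impI ballI)
  fix n :: nat and A :: "real mat"
  assume n: "1 \<le> n" and A: "A \<in> carrier_mat n n"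
  \<comment> \<open>The factor produced by elimination serves both the equivalence and the rank
    clause.\<close>
  have factor: "\<exists>R. cholesky_factor n A R \<and> (R $$ (n - 1, n - 1) = 0 \<longrightarrow>
      vec_space.rank n A = vec_space.rank (n - 1) (leading_principal_submatrix A (n - 1)))"
    if psd: "psd_mat A"
  proof -
    obtain m where m: "n = Suc m" using n by (cases n) auto
    obtain R where R: "cholesky_factor (Suc m) A R"
      "R $$ (m, m) = 0 \<Longrightarrow> \<exists>z \<in> carrier_vec (Suc m). z $ m = 1 \<and> A *\<^sub>v z = 0\<^sub>v (Suc m)"
      using psd_mat_cholesky[OF A[unfolded m] psd] by blast
    have "A\<^sup>T = A" using psd by (simp add: psd_mat_def)
    thus ?thesis
      using R rank_leading_block_of_kernel_vec[of A m] A leading_principal_submatrix_eq[of A "Suc m" m]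
      by (intro exI[of _ R]) (auto simp: m)
  qed
  show "psd_mat A \<longleftrightarrow> (\<exists>R. cholesky_factor n A R)"
    using factor cholesky_factor_imp_psd_mat by blast
  show "\<exists>R. cholesky_factor n A R \<and> (R $$ (n - 1, n - 1) = 0 \<longrightarrow>
      vec_space.rank n A = vec_space.rank (n - 1) (leading_principal_submatrix A (n - 1)))"
    if "psd_mat A" using factor[OF that] .
next
  show "\<exists>n \<ge> 1. \<exists>A \<in> carrier_mat n n. psd_mat A \<and>
      (\<exists>R R'. cholesky_factor n A R \<and> cholesky_factor n A R' \<and> R \<noteq> R')"
    using cholesky_factor_not_unique cholesky_factor_imp_psd_mat
    by (metis one_le_numeral)
qed

end
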